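(* Suppose that to every image $I$ and every point $p\in\mathbb{R}^2$ there is assigned a group feature $f_{l-1}^{I,p}:G\to\mathbb{R}^{n}$, and let $f_l^{I,p}:G\to\mathbb{R}^{m}$ be the output of a group convolution layer applied to it, that is, for all $g\in G$ and $1\le i\le m$, $$[f_l^{I,p}(g)]_i=\sigma\left(\sum_{h\in H}f_{l-1}^{I,p}(hg)^{T}\,W_i(h)+b_i\right).$$ If $f_{l-1}$ is equivariant to transformations in $G$, then $f_l$ is also equivariant to transformations in $G$.
   Context: $G$ is the group of planar transformations generated by rotations about a fixed origin and (positive, uniform) scalings about that origin, with composition as group law. For $g\in G$, $T_g:\mathbb{R}^2\to\mathbb{R}^2$ denotes the corresponding transformation of the plane, so $T_g\circ T_h=T_{gh}$. An image is a function $I:\mathbb{R}^2\to\mathbb{R}^c$ (for a fixed $c$), and the transformed image is $(T_g\circ I)(x)=I(T_g^{-1}(x))$. A group feature is a map $G\to\mathbb{R}^n$. Equivariance: an assignment $(I,p)\mapsto f^{I,p}$ of a group feature $f^{I,p}:G\to\mathbb{R}^n$ to each image $I$ and point $p$ is called equivariant to transformations in $G$ if for every image $I$, every point $p\in\mathbb{R}^2$ and every $k\in G$, $$f^{T_k\circ I,\,T_k(p)}(g)=f^{I,p}(gk)\quad\text{for all } g\in G.$$ Group convolution layer: the data of the layer are a finite subset $H\subset G$, weights $W_i:H\to\mathbb{R}^n$ and biases $b_i\in\mathbb{R}$ for $1\le i\le m$, and a function $\sigma:\mathbb{R}\to\mathbb{R}$ (the nonlinear activation), all fixed independently of $I$ and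 $p$. $[v]_i$ denotes the $i$-th coordinate of a vector $v$, and $hg$ is the product in $G$. *)

theory Defs
  imports "HOL-Analysis.Analysis" "HOL-Algebra.Bij" "HOL-Algebra.Generated_Groups"
begin

type_synonym plane = "real^2"

definition rotations_about :: "plane \<Rightarrow> (plane \<Rightarrow> plane) set" where
  "rotations_about org =
     {(\<lambda>x. org + Q *v (x - org)) | Q :: real^2^2. rotation_matrix Q}"

definition scalings_about :: "plane \<Rightarrow> (plane \<Rightarrow> plane) set" where
  "scalings_about org = {(\<lambda>x. org + s *\<^sub>R (x - org)) | s :: real. s > 0}"

text \<open>
  The subgroup of all bijections of the plane generated by the rotations and scalings about
  the origin \<open>org\<close>. Its elements are the transformations themselves, so the
  transformation \<open>T g\<close> attached to a group element \<open>g\<close> is \<open>g\<close>.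
\<close>

definition rot_scale_group :: "plane \<Rightarrow> (plane \<Rightarrow> plane) monoid" where
  "rot_scale_group org = (BijGroup UNIV)
     \<lparr>carrier := generate (BijGroup UNIV) (rotations_about org \<union> scalings_about org)\<rparr>"

definition transform_image :: "(plane \<Rightarrow> plane) \<Rightarrow> (plane \<Rightarrow> real^'c) \<Rightarrow> plane \<Rightarrow> real^'c" where
  "transform_image g I = (\<lambda>x. I (inv_into UNIV g x))"

text \<open>
  A group feature is represented by a function on all maps of the plane, of which only the
  values on the carrier of the group matter.
\<close>

definition equivariant ::
  "plane \<Rightarrow> ((plane \<Rightarrow> real^'c) \<Rightarrow> plane \<Rightarrow> (plane \<Rightarrow> plane) \<Rightarrow> real^'n) \<Rightarrow> bool" where
  "equivariant org f \<longleftrightarrow>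
     (\<forall>I p. \<forall>k \<in> carrier (rot_scale_group org). \<forall>g \<in> carrier (rot_scale_group org).
        f (transform_image k I) (k p) g = f I p (g \<otimes>\<^bsub>rot_scale_group org\<^esub> k))"

lemma generators_subset_Bij:
  "rotations_about org \<union> scalings_about org \<subseteq> carrier (BijGroup UNIV)"
proof -
  have rot: "bij (\<lambda>x. org + Q *v (x - org))" if "rotation_matrix Q" for Q :: "real^2^2"
  proof (rule o_bij[where g = "\<lambda>x. org + transpose Q *v (x - org)"])
    have "transpose Q ** Q = mat 1" "Q ** transpose Q = mat 1"
      using that by (auto simp: rotation_matrix_def orthogonal_matrix_def)
    then show "(\<lambda>x. org + transpose Q *v (x - org)) \<circ> (\<lambda>x. org + Q *v (x - org)) = id"
      "(\<lambda>x. org + Q *v (x - org)) \<circ> (\<lambda>x. org + transpose Q *v (x - org)) = id"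
      by (auto simp: fun_eq_iff matrix_vector_mul_assoc simp del: transpose_matrix_vector)
  qed
  have scal: "bij (\<lambda>x. org + s *\<^sub>R (x - org))" if "s > 0" for s :: real
    by (rule o_bij[where g = "\<lambda>x. org + inverse s *\<^sub>R (x - org)"])
      (use that in \<open>auto simp: fun_eq_iff\<close>)
  show ?thesis
    using rot scal by (auto simp: rotations_about_def scalings_about_def BijGroup_def Bij_def)
qed

lemma group_rot_scale_group: "group (rot_scale_group org)"
  unfolding rot_scale_group_def
  using group.generate_is_subgroup[OF group_BijGroup generators_subset_Bij]
  by (rule subgroup.subgroup_is_group[OF _ group_BijGroup])

lemma rot_scale_group_mult:
  assumes "g \<in> carrier (rot_scale_group org)" "h \<in> carrier (rot_scale_group org)"
  shows "g \<otimes>\<^bsub>rot_scale_group org\<^esub> h = g \<circ> h"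
proof -
  have "carrier (rot_scale_group org) \<subseteq> Bij UNIV"
    using group.generate_incl[OF group_BijGroup generators_subset_Bij, of org]
    by (auto simp: rot_scale_group_def BijGroup_def)
  then show ?thesis
    using assms by (auto simp: rot_scale_group_def BijGroup_def compose_def)
qed

end

theory Submission
  imports Defs
begin

text \<open>The layer multiplies the argument \<open>g\<close> by \<open>h\<close> on the left,
  while equivariance multiplies it by \<open>k\<close> on the right. Associativity, (hg)k = h(gk),
  lets the two actions commute, so equivariance passes to every summand. Weights, bias and
  \<open>\<sigma>\<close> depend on neither image, point nor \<open>g\<close>, so they preserve the
  equality.\<close>

theorem lemma2:
  fixes org :: plane
    and f_prev :: "(plane \<Rightarrow> real^'c) \<Rightarrow> plane \<Rightarrow> (plane \<Rightarrow> plane) \<Rightarrow> real^'n"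
    and f_next :: "(plane \<Rightarrow> real^'c) \<Rightarrow> plane \<Rightarrow> (plane \<Rightarrow> plane) \<Rightarrow> real^'m"
    and H :: "(plane \<Rightarrow> plane) set"
    and W :: "'m \<Rightarrow> (plane \<Rightarrow> plane) \<Rightarrow> real^'n"
    and b :: "'m \<Rightarrow> real"
    and \<sigma> :: "real \<Rightarrow> real"
  assumes "finite H" and "H \<subseteq> carrier (rot_scale_group org)"
    and "\<And>I p g i. g \<in> carrier (rot_scale_group org) \<Longrightarrow>
      f_next I p g $ i =
        \<sigma> ((\<Sum>h\<in>H. f_prev I p (h \<otimes>\<^bsub>rot_scale_group org\<^esub> g) \<bullet> W i h) + b i)"
    and "equivariant org f_prev"
  shows "equivariant org f_next"
proof -
  interpret G: group "rot_scale_group org"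
    by (rule group_rot_scale_group)
  show ?thesis
    unfolding equivariant_def
  proof (intro allI ballI)
    fix I :: "plane \<Rightarrow> real^'c" and p k g
    assume k: "k \<in> carrier (rot_scale_group org)" and g: "g \<in> carrier (rot_scale_group org)"
    \<comment> \<open>Equivariance of \<open>f_prev\<close> is used at the group element hg, not at
      \<open>g\<close>; this is where \<open>H\<close> must lie in the group.\<close>
    have "f_prev (transform_image k I) (k p) (h \<otimes>\<^bsub>rot_scale_group org\<^esub> g) =
        f_prev I p (h \<otimes>\<^bsub>rot_scale_group org\<^esub> (g \<otimes>\<^bsub>rot_scale_group org\<^esub> k))" if "h \<in> H" for h
    proof -
      have h: "h \<in> carrier (rot_scale_group org)"
        using that assms(2) by blast
      show ?thesis
        using assms(4) k G.m_closed[OF h g] by (simp add: equivariant_def G.m_assoc[OF h g k])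
    qed
    then show "f_next (transform_image k I) (k p) g = f_next I p (g \<otimes>\<^bsub>rot_scale_group org\<^esub> k)"
      \<comment> \<open>Only equations for \<open>f_next\<close> are split into coordinates, since
        the layer formula is coordinatewise; the equation for \<open>f_prev\<close> stays a vector
        equation and rewrites inside the sum. Closure gives the formula at gk.\<close>
      unfolding vec_eq_iff[of "f_next _ _ _"] by (simp add: assms(3) g G.m_closed[OF g k])
  qed
qed

end
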